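(* Let $\mathcal{H}$ be a Hilbert space of dimension $d$ with a fixed orthonormal reference basis $\{|i\rangle\}_{i=0}^{d-1}$, let $\mathscr{I}$ be the set of all states on $\mathcal{H}$ that are incoherent with respect to this basis, let $\widehat{A}$ be an observable on $\mathcal{H}$, and let $A^{\min}_{\mathrm{inc}}:=\min_{\rho\in\mathscr{I}}\operatorname{Tr}[\rho\widehat{A}]$. If a state $\chi$ on $\mathcal{H}$ satisfies $\operatorname{Tr}[\chi\widehat{A}]<A^{\min}_{\mathrm{inc}}$, then $\chi$ is a coherent state with respect to the reference basis.
   Context: A state (density operator) on $\mathcal{H}$ is incoherent with respect to the basis $\{|i\rangle\}$ if it is diagonal in that basis, i.e. of the form $\sum_i p_i|i\rangle\langle i|$ with $p_i\ge 0$ and $\sum_i p_i=1$. A state is coherent with respect to the basis if it is not incoherent with respect to it. An observable is a Hermitian operator. *)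

theory Defs
  imports Complex_Main
begin

(* Complex inner product spaces whose carrier is the whole type. The inner product is linear in its
   second argument. In the presence of a finite orthonormal basis such a space is complete, hence a
   Hilbert space. *)
locale complex_inner_space = vector_space scale
  for scale :: "complex \<Rightarrow> 'h::ab_group_add \<Rightarrow> 'h" +
  fixes cinner :: "'h \<Rightarrow> 'h \<Rightarrow> complex"
  assumes cinner_add_right: "cinner x (y + z) = cinner x y + cinner x z"
    and cinner_scale_right: "cinner x (scale c y) = c * cinner x y"
    and cinner_commute: "cinner x y = cnj (cinner y x)"
    and cinner_pos: "x \<noteq> 0 \<Longrightarrow> 0 < Re (cinner x x)"

definition orthonormal_basis ::
  "(complex \<Rightarrow> 'h::ab_group_add \<Rightarrow> 'h) \<Rightarrow> ('h \<Rightarrow> 'h \<Rightarrow> complex) \<Rightarrow> nat \<Rightarrow> (nat \<Rightarrow> 'h) \<Rightarrow> bool" where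
  "orthonormal_basis scale cinner n e \<longleftrightarrow>
     (\<forall>i<n. \<forall>j<n. cinner (e i) (e j) = (if i = j then 1 else 0)) \<and>
     module.span scale (e ` {..<n}) = UNIV"

(* The common value of the sum of the diagonal matrix elements of T over all orthonormal bases; see
   op_trace_eq for its existence. *)
definition op_trace ::
  "(complex \<Rightarrow> 'h::ab_group_add \<Rightarrow> 'h) \<Rightarrow> ('h \<Rightarrow> 'h \<Rightarrow> complex) \<Rightarrow> ('h \<Rightarrow> 'h) \<Rightarrow> complex" where
  "op_trace scale cinner T =
     (THE t. \<forall>n e. orthonormal_basis scale cinner n e \<longrightarrow> t = (\<Sum>i<n. cinner (e i) (T (e i))))"

definition observable ::
  "(complex \<Rightarrow> 'h::ab_group_add \<Rightarrow> 'h) \<Rightarrow> ('h \<Rightarrow> 'h \<Rightarrow> complex) \<Rightarrow> ('h \<Rightarrow> 'h) \<Rightarrow> bool" where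
  "observable scale cinner A \<longleftrightarrow>
     Vector_Spaces.linear scale scale A \<and> (\<forall>x y. cinner x (A y) = cinner (A x) y)"

definition density_operator ::
  "(complex \<Rightarrow> 'h::ab_group_add \<Rightarrow> 'h) \<Rightarrow> ('h \<Rightarrow> 'h \<Rightarrow> complex) \<Rightarrow> ('h \<Rightarrow> 'h) \<Rightarrow> bool" where
  "density_operator scale cinner \<rho> \<longleftrightarrow>
     Vector_Spaces.linear scale scale \<rho> \<and>
     (\<forall>x y. cinner x (\<rho> y) = cinner (\<rho> x) y) \<and>
     (\<forall>x. 0 \<le> Re (cinner x (\<rho> x))) \<and>
     op_trace scale cinner \<rho> = 1"

(* The operator |u><v|. *)
definition ketbra ::
  "(complex \<Rightarrow> 'h::ab_group_add \<Rightarrow> 'h) \<Rightarrow> ('h \<Rightarrow> 'h \<Rightarrow> complex) \<Rightarrow> 'h \<Rightarrow> 'h \<Rightarrow> 'h \<Rightarrow> 'h" where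
  "ketbra scale cinner u v x = scale (cinner v x) u"

definition incoherent_states ::
  "(complex \<Rightarrow> 'h::ab_group_add \<Rightarrow> 'h) \<Rightarrow> ('h \<Rightarrow> 'h \<Rightarrow> complex) \<Rightarrow> nat \<Rightarrow> (nat \<Rightarrow> 'h) \<Rightarrow> ('h \<Rightarrow> 'h) set" where
  "incoherent_states scale cinner d e =
     {\<rho>. density_operator scale cinner \<rho> \<and>
          (\<exists>p :: nat \<Rightarrow> real. (\<forall>i<d. 0 \<le> p i) \<and> (\<Sum>i<d. p i) = 1 \<and>
             \<rho> = (\<lambda>x. \<Sum>i<d. scale (complex_of_real (p i)) (ketbra scale cinner (e i) (e i) x)))}"

definition coherent_state ::
  "(complex \<Rightarrow> 'h::ab_group_add \<Rightarrow> 'h) \<Rightarrow> ('h \<Rightarrow> 'h \<Rightarrow> complex) \<Rightarrow> nat \<Rightarrow> (nat \<Rightarrow> 'h) \<Rightarrow> ('h \<Rightarrow> 'h) \<Rightarrow> bool" where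
  "coherent_state scale cinner d e \<rho> \<longleftrightarrow>
     density_operator scale cinner \<rho> \<and> \<rho> \<notin> incoherent_states scale cinner d e"

(* Tr[rho A], which is real whenever rho is a state and A an observable (op_trace_real). *)
definition expectation_value ::
  "(complex \<Rightarrow> 'h::ab_group_add \<Rightarrow> 'h) \<Rightarrow> ('h \<Rightarrow> 'h \<Rightarrow> complex) \<Rightarrow> ('h \<Rightarrow> 'h) \<Rightarrow> ('h \<Rightarrow> 'h) \<Rightarrow> real" where
  "expectation_value scale cinner \<rho> A = Re (op_trace scale cinner (\<rho> \<circ> A))"

(* The least element of the set of expectation values; see inc_min_attained for its existence. *)
definition inc_min ::
  "(complex \<Rightarrow> 'h::ab_group_add \<Rightarrow> 'h) \<Rightarrow> ('h \<Rightarrow> 'h \<Rightarrow> complex) \<Rightarrow> nat \<Rightarrow> (nat \<Rightarrow> 'h) \<Rightarrow> ('h \<Rightarrow> 'h) \<Rightarrow> real" where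
  "inc_min scale cinner d e A =
     (LEAST v. v \<in> (\<lambda>\<rho>. expectation_value scale cinner \<rho> A) ` incoherent_states scale cinner d e)"

context complex_inner_space
begin

lemma cinner_zero_right [simp]: "cinner x 0 = 0"
  using cinner_add_right[of x 0 0] by simp

lemma cinner_sum_right: "cinner x (\<Sum>i\<in>S. f i) = (\<Sum>i\<in>S. cinner x (f i))"
  by (induction S rule: infinite_finite_induct) (simp_all add: cinner_add_right)

lemma cinner_scale_left: "cinner (scale c x) y = cnj c * cinner x y"
  by (metis cinner_commute cinner_scale_right complex_cnj_mult)

lemma cinner_sum_left: "cinner (\<Sum>i\<in>S. f i) y = (\<Sum>i\<in>S. cinner (f i) y)"
  by (subst cinner_commute, subst cinner_sum_right, simp add: cnj_sum)
    (rule sum.cong[OF refl], rule cinner_commute[symmetric])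

lemma basis_expansion:
  assumes "orthonormal_basis scale cinner n e"
  shows "x = (\<Sum>i<n. scale (cinner (e i) x) (e i))"
proof -
  let ?S = "{x. x = (\<Sum>i<n. scale (cinner (e i) x) (e i))}"
  have on: "\<And>i j. i < n \<Longrightarrow> j < n \<Longrightarrow> cinner (e i) (e j) = (if i = j then 1 else 0)"
    and sp: "span (e ` {..<n}) = UNIV"
    using assms by (auto simp: orthonormal_basis_def)
  have sub: "subspace ?S"
    unfolding subspace_def
    by (auto simp: cinner_add_right cinner_scale_right scale_left_distrib sum.distrib)
      (metis (no_types, lifting) scale_scale scale_sum_right sum.cong)
  have "e ` {..<n} \<subseteq> ?S"
  proof
    fix y assume "y \<in> e ` {..<n}"
    then obtain j where j: "j < n" "y = e j" by auto
    have "(\<Sum>i<n. scale (cinner (e i) (e j)) (e i)) = (\<Sum>i<n. if i = j then e j else 0)"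
      using j(1) on by (intro sum.cong) auto
    then show "y \<in> ?S" using j by simp
  qed
  then have "span (e ` {..<n}) \<subseteq> ?S" using sub by (rule span_minimal)
  then show ?thesis using sp by auto
qed

lemma trace_basis_independent:
  assumes T: "Vector_Spaces.linear scale scale T"
    and e: "orthonormal_basis scale cinner n e" and f: "orthonormal_basis scale cinner m f"
  shows "(\<Sum>i<n. cinner (e i) (T (e i))) = (\<Sum>j<m. cinner (f j) (T (f j)))"
proof -
  interpret T: Vector_Spaces.linear scale scale T by (rule T)
  have "(\<Sum>i<n. cinner (e i) (T (e i))) = (\<Sum>i<n. \<Sum>j<m. cinner (f j) (e i) * cinner (e i) (T (f j)))"
  proof (rule sum.cong[OF refl])
    fix i
    have "T (e i) = T (\<Sum>j<m. scale (cinner (f j) (e i)) (f j))"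
      using basis_expansion[OF f, of "e i"] by simp
    then show "cinner (e i) (T (e i)) = (\<Sum>j<m. cinner (f j) (e i) * cinner (e i) (T (f j)))"
      by (simp add: T.sum T.scale cinner_sum_right cinner_scale_right)
  qed
  also have "\<dots> = (\<Sum>j<m. \<Sum>i<n. cinner (f j) (e i) * cinner (e i) (T (f j)))"
    by (rule sum.swap)
  also have "\<dots> = (\<Sum>j<m. cinner (f j) (T (f j)))"
  proof (rule sum.cong[OF refl])
    fix j
    have "cinner (f j) (T (f j)) = cinner (f j) (\<Sum>i<n. scale (cinner (e i) (T (f j))) (e i))"
      using basis_expansion[OF e, of "T (f j)"] by simp
    then show "(\<Sum>i<n. cinner (f j) (e i) * cinner (e i) (T (f j))) = cinner (f j) (T (f j))"
      by (simp add: cinner_sum_right cinner_scale_right mult.commute)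
  qed
  finally show ?thesis .
qed

lemma op_trace_eq:
  assumes "Vector_Spaces.linear scale scale T" and "orthonormal_basis scale cinner n e"
  shows "op_trace scale cinner T = (\<Sum>i<n. cinner (e i) (T (e i)))"
  unfolding op_trace_def
  using assms trace_basis_independent by (intro the_equality) blast+

lemma op_trace_real:
  assumes e: "orthonormal_basis scale cinner n e"
    and A: "observable scale cinner A" and r: "density_operator scale cinner \<rho>"
  shows "op_trace scale cinner (\<rho> \<circ> A) \<in> \<real>"
proof -
  have lA: "Vector_Spaces.linear scale scale A" and lr: "Vector_Spaces.linear scale scale \<rho>"
    and hA: "\<And>x y. cinner x (A y) = cinner (A x) y" and hr: "\<And>x y. cinner x (\<rho> y) = cinner (\<rho> x) y"
    using A r by (auto simp: observable_def density_operator_def)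
  have l1: "Vector_Spaces.linear scale scale (\<rho> \<circ> A)" using lA lr by (rule Vector_Spaces.linear_compose)
  have t: "op_trace scale cinner (\<rho> \<circ> A) = (\<Sum>i<n. cinner (\<rho> (e i)) (A (e i)))"
    by (simp add: op_trace_eq[OF l1 e] hr)
  have exp: "cinner (\<rho> (e i)) (A (e i)) = (\<Sum>j<n. cinner (\<rho> (e i)) (e j) * cinner (e j) (A (e i)))" for i
  proof -
    have "cinner (\<rho> (e i)) (A (e i)) = cinner (\<rho> (e i)) (\<Sum>j<n. scale (cinner (e j) (A (e i))) (e j))"
      using basis_expansion[OF e, of "A (e i)"] by simp
    then show ?thesis by (simp add: cinner_sum_right cinner_scale_right mult.commute)
  qed
  let ?s = "\<Sum>i<n. \<Sum>j<n. cinner (\<rho> (e i)) (e j) * cinner (e j) (A (e i))"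
  have cr: "cnj (cinner (\<rho> (e i)) (e j)) = cinner (\<rho> (e j)) (e i)" for i j
    by (metis hr cinner_commute)
  have cA: "cnj (cinner (e j) (A (e i))) = cinner (e i) (A (e j))" for i j
    by (metis hA cinner_commute)
  have "cnj ?s = (\<Sum>i<n. \<Sum>j<n. cinner (\<rho> (e j)) (e i) * cinner (e i) (A (e j)))"
    by (simp add: cnj_sum cr cA)
  also have "\<dots> = ?s" by (rule sum.swap)
  finally show ?thesis using t exp by (simp add: Reals_cnj_iff)
qed

lemma ketbra_state:
  assumes e: "orthonormal_basis scale cinner d e" and k: "k < d"
  shows "ketbra scale cinner (e k) (e k) \<in> incoherent_states scale cinner d e"
proof -
  let ?K = "ketbra scale cinner (e k) (e k)"
  have on: "\<And>i j. i < d \<Longrightarrow> j < d \<Longrightarrow> cinner (e i) (e j) = (if i = j then 1 else 0)"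
    using e by (auto simp: orthonormal_basis_def)
  have l: "Vector_Spaces.linear scale scale ?K"
    by unfold_locales
      (auto simp: ketbra_def cinner_add_right cinner_scale_right scale_left_distrib)
  have h: "cinner x (?K y) = cinner (?K x) y" for x y
    unfolding ketbra_def cinner_scale_right cinner_scale_left
    by (metis cinner_commute mult.commute)
  have p: "0 \<le> Re (cinner x (?K x))" for x
  proof -
    have "cinner x (?K x) = cnj (cinner x (e k)) * cinner x (e k)"
      unfolding ketbra_def cinner_scale_right by (metis cinner_commute)
    then show ?thesis by simp
  qed
  have "op_trace scale cinner ?K = (\<Sum>i<d. if i = k then 1 else 0)"
    unfolding op_trace_eq[OF l e]
    by (rule sum.cong) (auto simp: ketbra_def cinner_scale_right on k)
  then have t: "op_trace scale cinner ?K = 1" using k by simp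
  have "?K = (\<lambda>x. \<Sum>i<d. scale (complex_of_real (if i = k then 1 else 0)) (ketbra scale cinner (e i) (e i) x))"
  proof
    fix x
    have "(\<Sum>i<d. scale (complex_of_real (if i = k then 1 else 0)) (ketbra scale cinner (e i) (e i) x))
        = (\<Sum>i<d. if i = k then ?K x else 0)"
      by (rule sum.cong) auto
    then show "?K x = (\<Sum>i<d. scale (complex_of_real (if i = k then 1 else 0)) (ketbra scale cinner (e i) (e i) x))"
      using k by simp
  qed
  then show ?thesis
    unfolding incoherent_states_def density_operator_def
    using l h p t k
    by (auto intro!: exI[of _ "\<lambda>i. if i = k then 1 else (0::real)"])
qed

lemma expectation_value_diagonal:
  assumes e: "orthonormal_basis scale cinner d e" and A: "observable scale cinner A"
    and r: "density_operator scale cinner \<rho>"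
    and p: "\<rho> = (\<lambda>x. \<Sum>i<d. scale (complex_of_real (p i)) (ketbra scale cinner (e i) (e i) x))"
  shows "expectation_value scale cinner \<rho> A = (\<Sum>i<d. p i * Re (cinner (e i) (A (e i))))"
proof -
  have on: "\<And>i j. i < d \<Longrightarrow> j < d \<Longrightarrow> cinner (e i) (e j) = (if i = j then 1 else 0)"
    using e by (auto simp: orthonormal_basis_def)
  have l: "Vector_Spaces.linear scale scale (\<rho> \<circ> A)"
    using A r by (auto simp: observable_def density_operator_def intro: Vector_Spaces.linear_compose)
  have d: "cinner (e k) (\<rho> y) = complex_of_real (p k) * cinner (e k) y" if "k < d" for k y
  proof -
    have "cinner (e k) (\<rho> y) = (\<Sum>i<d. complex_of_real (p i) * (cinner (e i) y * cinner (e k) (e i)))"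
      unfolding p ketbra_def by (simp only: cinner_sum_right cinner_scale_right)
    also have "\<dots> = (\<Sum>i<d. if i = k then complex_of_real (p k) * cinner (e k) y else 0)"
      using that by (intro sum.cong) (auto simp: on)
    finally show ?thesis using that by simp
  qed
  show ?thesis
    unfolding expectation_value_def op_trace_eq[OF l e] by (simp add: d)
qed

lemma inc_min_attained:
  assumes e: "orthonormal_basis scale cinner d e" and A: "observable scale cinner A" and "0 < d"
  shows "inc_min scale cinner d e A
      \<in> (\<lambda>\<rho>. expectation_value scale cinner \<rho> A) ` incoherent_states scale cinner d e"
    and "\<rho> \<in> incoherent_states scale cinner d e
      \<Longrightarrow> inc_min scale cinner d e A \<le> expectation_value scale cinner \<rho> A"
proof -
  let ?V = "(\<lambda>\<rho>. expectation_value scale cinner \<rho> A) ` incoherent_states scale cinner d e"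
  let ?a = "\<lambda>i. Re (cinner (e i) (A (e i)))"
  define m where "m = Min (?a ` {..<d})"
  have "m \<in> ?a ` {..<d}" unfolding m_def using \<open>0 < d\<close> by (intro Min_in) auto
  then obtain k where k: "k < d" "m = ?a k" by auto
  have K: "ketbra scale cinner (e k) (e k) \<in> incoherent_states scale cinner d e"
    by (rule ketbra_state[OF e k(1)])
  have "expectation_value scale cinner (ketbra scale cinner (e k) (e k)) A
      = (\<Sum>i<d. (if i = k then 1 else 0) * ?a i)"
  proof (rule expectation_value_diagonal[OF e A])
    show "density_operator scale cinner (ketbra scale cinner (e k) (e k))"
      using K by (simp add: incoherent_states_def)
    show "ketbra scale cinner (e k) (e k) = (\<lambda>x. \<Sum>i<d. scale (complex_of_real (if i = k then 1 else 0)) (ketbra scale cinner (e i) (e i) x))"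
      using k(1) by (auto simp: fun_eq_iff if_distrib[of complex_of_real] if_distrib[of "\<lambda>c. scale c _"] cong: if_cong)
  qed
  also have "\<dots> = (\<Sum>i<d. if i = k then ?a k else 0)"
    by (rule sum.cong) auto
  finally have mV: "m \<in> ?V" using k K by (intro image_eqI[OF _ K]) auto
  have lb: "m \<le> v" if vV: "v \<in> ?V" for v
  proof -
    obtain \<rho> where r: "\<rho> \<in> incoherent_states scale cinner d e"
      and v: "v = expectation_value scale cinner \<rho> A" using vV by auto
    from r obtain p :: "nat \<Rightarrow> real" where dens: "density_operator scale cinner \<rho>"
      and p: "\<And>i. i < d \<Longrightarrow> 0 \<le> p i" "(\<Sum>i<d. p i) = 1"
      and rho: "\<rho> = (\<lambda>x. \<Sum>i<d. scale (complex_of_real (p i)) (ketbra scale cinner (e i) (e i) x))"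
      unfolding incoherent_states_def by blast
    have "v = (\<Sum>i<d. p i * ?a i)" unfolding v by (rule expectation_value_diagonal[OF e A dens rho])
    moreover have "(\<Sum>i<d. p i * m) \<le> (\<Sum>i<d. p i * ?a i)"
      using p by (intro sum_mono mult_left_mono) (auto simp: m_def)
    ultimately show ?thesis using p(2) by (simp flip: sum_distrib_right)
  qed
  have "inc_min scale cinner d e A = m"
    unfolding inc_min_def using mV lb by (intro Least_equality) auto
  then show "inc_min scale cinner d e A \<in> ?V"
    and "\<rho> \<in> incoherent_states scale cinner d e
      \<Longrightarrow> inc_min scale cinner d e A \<le> expectation_value scale cinner \<rho> A"
    using mV lb by auto
qed

end

end

theory Submission
  imports Defs
begin

text \<open>In an incoherent state the expectation of \<open>A\<close> is a convex combination of
  the diagonal entries of \<open>A\<close> in the basis \<open>e\<close>, hence at least the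
  smallest entry, which a basis projector attains. So \<open>inc_min\<close> is a true lower bound
  on the incoherent states (\<open>inc_min_attained\<close>), and a state strictly below it cannot
  be one of them.\<close>

theorem corollary4:
  fixes scale :: "complex \<Rightarrow> 'h::ab_group_add \<Rightarrow> 'h"
    and cinner :: "'h \<Rightarrow> 'h \<Rightarrow> complex"
    and d :: nat
    and e :: "nat \<Rightarrow> 'h"
    and A \<chi> :: "'h \<Rightarrow> 'h"
  assumes "complex_inner_space scale cinner"
    and "vector_space.dim scale (UNIV :: 'h set) = d"
    and "orthonormal_basis scale cinner d e"
    and "observable scale cinner A"
    and "density_operator scale cinner \<chi>"
    and "expectation_value scale cinner \<chi> A < inc_min scale cinner d e A"
  shows "coherent_state scale cinner d e \<chi>"
proof -
  interpret complex_inner_space scale cinner by fact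
  have "\<chi> \<notin> incoherent_states scale cinner d e"
  proof
    assume \<chi>: "\<chi> \<in> incoherent_states scale cinner d e"
    \<comment> \<open>In dimension 0 the weights of an incoherent state would have the empty sum 0
      instead of 1. Positivity of \<open>d\<close> ensures that the minimum exists.\<close>
    then have "0 < d" by (cases "d = 0") (auto simp: incoherent_states_def)
    then show False using inc_min_attained(2)[OF assms(3,4) _ \<chi>] assms(6) by simp
  qed
  then show ?thesis using assms(5) by (simp add: coherent_state_def)
qed

end
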